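(* Let $(X,d)$ be a complete separable metric space in which closed balls are compact and let $\mu$ be a Borel probability measure on $X$. Let $\theta:\mathbb{R}^+\to\mathbb{R}^+$ be any function such that $\theta(x)\ge\min(x^2,a^2)$ for all $x\geq 0$, for some $a>0$, and such that the cost $(x,y)\mapsto\theta(d(x,y))$ is continuous on $X\times X$. If $\mu$ satisfies ${\bf T}_\theta(C)$ for some $C>0$, then it satisfies the Poincaré inequality $$\mathrm{Var}_\mu(f)\le\frac C2\int|\nabla^-f|^2\,d\mu$$ for all bounded functions $f:X\to\mathbb{R}$ such that $\mathrm{Lip}(f,r)<\infty$ for some $r>0$.
   Context: $\mu$ satisfies ${\bf T}_\theta(C)$ if $\mathcal{T}_\theta(\mu,\nu)\le C\,H(\nu|\mu)$ for all Borel probability measures $\nu$ on $X$, where $\mathcal{T}_\theta(\nu_1,\nu_2)=\inf_\pi\iint\theta(d(x,y))\,\pi(dx\,dy)$, the infimum being over all probability measures $\pi$ on $X\times X$ with marginals $\nu_1,\nu_2$, and $H(\nu|\mu)=\int\log\frac{d\nu}{d\mu}\,d\nu$ if $\nu\ll\mu$, $+\infty$ otherwise. $|\nabla^-f|(x)=\limsup_{y\to x}\frac{[f(y)-f(x)]_-}{d(x,y)}$ (negative part; $0$ if $x$ is isolated). $\mathrm{Lip}(f,r)=\sup\left\{\frac{|f(y)-f(x)|}{d(x,y)}:\ x\ne y,\ d(x,y)\le r\right\}$. $\mathrm{Var}_\mu(f)=\int f^2\,d\mu-\left(\int f\,d\mu\right)^2$. *)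

theory Defs
  imports "HOL-Probability.Probability"
begin

definition couplings ::
    "'a::polish_space measure \<Rightarrow> 'a measure \<Rightarrow> ('a \<times> 'a) measure set" where
  "couplings \<nu>\<^sub>1 \<nu>\<^sub>2 =
    {\<pi>. prob_space \<pi> \<and> sets \<pi> = sets (borel \<Otimes>\<^sub>M borel) \<and>
         distr \<pi> borel fst = \<nu>\<^sub>1 \<and> distr \<pi> borel snd = \<nu>\<^sub>2}"

definition transport_cost ::
    "(real \<Rightarrow> real) \<Rightarrow> 'a::polish_space measure \<Rightarrow> 'a measure \<Rightarrow> ennreal" where
  "transport_cost \<theta> \<nu>\<^sub>1 \<nu>\<^sub>2 =
    (INF \<pi>\<in>couplings \<nu>\<^sub>1 \<nu>\<^sub>2. \<integral>\<^sup>+ (x, y). ennreal (\<theta> (dist x y)) \<partial>\<pi>)"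

(* The integral of log (d\<nu>/d\<mu>) against \<nu> is taken in the extended reals, as the integral
   of the positive part minus that of the negative part; the latter is at most 1/e for
   probability measures. KL_divergence itself would give 0 when the integral is +\<infinity>. *)
definition relative_entropy :: "'a measure \<Rightarrow> 'a measure \<Rightarrow> ereal" where
  "relative_entropy \<nu> \<mu> =
    (if absolutely_continuous \<mu> \<nu> then
       enn2ereal (\<integral>\<^sup>+ x. ennreal (entropy_density (exp 1) \<mu> \<nu> x) \<partial>\<nu>) -
       enn2ereal (\<integral>\<^sup>+ x. ennreal (- entropy_density (exp 1) \<mu> \<nu> x) \<partial>\<nu>)
     else \<infinity>)"

lemma relative_entropy_eq_KL_divergence:
  assumes "absolutely_continuous \<mu> \<nu>" "integrable \<nu> (entropy_density (exp 1) \<mu> \<nu>)"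
  shows "relative_entropy \<nu> \<mu> = ereal (KL_divergence (exp 1) \<mu> \<nu>)"
proof -
  let ?L = "entropy_density (exp 1) \<mu> \<nu>"
  obtain r q where r: "0 \<le> r" "(\<integral>\<^sup>+ x. ennreal (?L x) \<partial>\<nu>) = ennreal r"
    and q: "0 \<le> q" "(\<integral>\<^sup>+ x. ennreal (- ?L x) \<partial>\<nu>) = ennreal q"
    and "integral\<^sup>L \<nu> ?L = r - q"
    using assms(2) by (rule integrableE)
  then show ?thesis
    using assms(1) by (simp add: relative_entropy_def KL_divergence_def enn2ereal_ennreal)
qed

definition transport_entropy_ineq ::
    "(real \<Rightarrow> real) \<Rightarrow> real \<Rightarrow> 'a::polish_space measure \<Rightarrow> bool" where
  "transport_entropy_ineq \<theta> C \<mu> \<longleftrightarrow>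
    (\<forall>\<nu>. prob_space \<nu> \<and> sets \<nu> = sets borel \<longrightarrow>
         enn2ereal (transport_cost \<theta> \<mu> \<nu>) \<le> ereal C * relative_entropy \<nu> \<mu>)"

definition descending_slope :: "('a::metric_space \<Rightarrow> real) \<Rightarrow> 'a \<Rightarrow> ennreal" where
  "descending_slope f x = Limsup (at x) (\<lambda>y. ennreal (max 0 (- (f y - f x)) / dist x y))"

(* The convention for isolated points is built in: there the filter (at x) is trivial. *)
lemma descending_slope_isolated:
  assumes "\<not> x islimpt UNIV"
  shows "descending_slope f x = 0"
proof -
  have "at x = bot"
    using assms by (simp add: trivial_limit_within)
  then show ?thesis
    by (simp add: descending_slope_def bot_ennreal)
qed

definition Lip :: "('a::metric_space \<Rightarrow> real) \<Rightarrow> real \<Rightarrow> ennreal" where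
  "Lip f r = (SUP (x, y)\<in>{(x, y). x \<noteq> y \<and> dist x y \<le> r}. ennreal (\<bar>f y - f x\<bar> / dist x y))"

definition Var :: "'a measure \<Rightarrow> ('a \<Rightarrow> real) \<Rightarrow> real" where
  "Var \<mu> f = (\<integral>x. (f x)\<^sup>2 \<partial>\<mu>) - (\<integral>x. f x \<partial>\<mu>)\<^sup>2"

end

theory Submission
  imports Defs
begin

text \<open>
  Perturb \<open>\<mu>\<close> to \<open>\<nu> = (1 - \<epsilon> g) \<mu>\<close> with \<open>g = f - \<integral>f d\<mu>\<close>, so that \<open>\<integral>f d\<mu> - \<integral>f d\<nu> = \<epsilon> Var f\<close>,
  while \<open>H(\<nu>|\<mu>) = \<epsilon>\<^sup>2 Var f / 2 + O(\<epsilon>\<^sup>3)\<close>. Let \<open>\<sigma>\<close> be the largest descending difference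
  quotient at scale \<open>\<delta>\<close>. Young's inequality for \<open>d(x,y) < \<delta>\<close>, and \<open>\<theta>(d(x,y)) \<ge> \<delta>\<^sup>2\<close> otherwise, give
  \<open>f(x) - f(y) \<le> \<eta> \<sigma>(x)\<^sup>2 / 2 + (1 / (2\<eta>) + 2M / \<delta>\<^sup>2) \<theta>(d(x,y))\<close>. Integrate this against
  an arbitrary coupling of \<open>\<mu>\<close> and \<open>\<nu>\<close>, apply the transport-entropy inequality with
  \<open>\<eta> = \<epsilon> C / 2\<close>, divide by \<open>\<epsilon>\<close> and let \<open>\<epsilon> \<rightarrow> 0\<close>: then \<open>Var f \<le> (C / 4) \<integral>\<sigma>\<^sup>2 d\<mu> + Var f / 2\<close>.
  Finally let \<open>\<delta> \<rightarrow> 0\<close>.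
\<close>

section \<open>Entropy of a small perturbation of a probability measure\<close>

text \<open>The right side minus the left vanishes at 0 and has derivative
  \<open>t ^ 3 / (1 + t)\<close>, which has the sign of \<open>t\<close>; so 0 is its minimum on the
  half-line above -1.\<close>

lemma ln_one_plus_le_cubic:
  fixes u :: real
  assumes "-1 < u"
  shows "ln (1 + u) \<le> u - u\<^sup>2 / 2 + u ^ 3 / 3"
proof -
  define h where "h = (\<lambda>u::real. u - u\<^sup>2 / 2 + u ^ 3 / 3 - ln (1 + u))"
  have der: "(h has_real_derivative t ^ 3 / (1 + t)) (at t)" if "-1 < t" for t
    unfolding h_def using that
    by (auto intro!: derivative_eq_intros simp: field_simps power2_eq_square power3_eq_cube)
  have "h 0 \<le> h u"
  proof (cases "0 \<le> u")
    case True
    show ?thesis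
      by (rule DERIV_nonneg_imp_nondecreasing[OF True]) (use der in force)
  next
    case False
    then have "u \<le> 0" by simp
    show ?thesis
    proof (rule DERIV_nonpos_imp_nonincreasing[OF \<open>u \<le> 0\<close>])
      fix t assume "u \<le> t" "t \<le> 0"
      with assms show "\<exists>y. (h has_real_derivative y) (at t) \<and> y \<le> 0"
        using der[of t] by (force simp: divide_nonpos_pos power3_eq_cube mult_nonneg_nonpos)
    qed
  qed
  then show ?thesis
    by (simp add: h_def)
qed

text \<open>Multiplying the cubic bound by \<open>1 + u\<close> leaves the remainder
  \<open>u ^ 3 * (u / 3 - 1 / 6)\<close>, whose second factor is at most 1 in absolute value. The
  left side is the entropy integrand for the density \<open>1 + u\<close>.\<close>

lemma one_plus_times_ln_le:
  fixes u :: real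
  assumes "\<bar>u\<bar> \<le> 1 / 2"
  shows "(1 + u) * ln (1 + u) \<le> u + u\<^sup>2 / 2 + \<bar>u\<bar> ^ 3"
proof -
  have "(1 + u) * ln (1 + u) \<le> (1 + u) * (u - u\<^sup>2 / 2 + u ^ 3 / 3)"
    using assms by (intro mult_left_mono ln_one_plus_le_cubic) auto
  also have "\<dots> = u + u\<^sup>2 / 2 + u ^ 3 * (u / 3 - 1 / 6)"
    by (simp add: field_simps power2_eq_square power3_eq_cube)
  also have "u ^ 3 * (u / 3 - 1 / 6) \<le> \<bar>u\<bar> ^ 3 * 1"
  proof -
    have "u ^ 3 * (u / 3 - 1 / 6) \<le> \<bar>u\<bar> ^ 3 * \<bar>u / 3 - 1 / 6\<bar>"
      by (metis abs_ge_self abs_mult power_abs)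
    also have "\<dots> \<le> \<bar>u\<bar> ^ 3 * 1"
      using assms by (intro mult_left_mono) auto
    finally show ?thesis .
  qed
  finally show ?thesis by simp
qed

text \<open>The zero mean of \<open>u\<close> is used twice: it gives the density total mass 1, and
  it removes the linear term when the pointwise bound on \<open>(1 + u) * ln (1 + u)\<close> is
  integrated. What is left is the quadratic term and a cubic error.\<close>

lemma (in prob_space)
  fixes u :: "'a \<Rightarrow> real"
  assumes u[measurable]: "u \<in> borel_measurable M"
    and u_le: "\<And>x. \<bar>u x\<bar> \<le> k" and k: "k \<le> 1 / 2"
    and mean: "expectation u = 0"
  shows prob_space_density_one_plus: "prob_space (density M (\<lambda>x. ennreal (1 + u x)))"
    and relative_entropy_density_one_plus_le:
      "relative_entropy (density M (\<lambda>x. ennreal (1 + u x))) M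
        \<le> ereal (expectation (\<lambda>x. (u x)\<^sup>2) / 2 + k ^ 3)"
proof -
  let ?N = "density M (\<lambda>x. ennreal (1 + u x))"
  let ?D = "entropy_density (exp 1) M ?N"
  have u_half: "\<bar>u x\<bar> \<le> 1 / 2" for x
    using u_le[of x] k by linarith
  then have nn: "0 \<le> 1 + u x" for x
    using u_half[of x] by linarith
  have int_u: "integrable M u"
    by (rule integrable_const_bound[where B = k]) (auto simp: u_le)
  have int_u2: "integrable M (\<lambda>x. (u x)\<^sup>2)"
    by (rule integrable_const_bound[where B = "k\<^sup>2"])
      (auto simp: u_le abs_le_square_iff[symmetric] intro: order_trans[OF u_le abs_ge_self])
  show ps: "prob_space ?N"
  proof
    have "emeasure ?N (space ?N) = (\<integral>\<^sup>+x. ennreal (1 + u x) \<partial>M)"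
      by (simp add: emeasure_density cong: nn_integral_cong_simp)
    also have "\<dots> = ennreal (expectation (\<lambda>x. 1 + u x))"
      using int_u nn by (intro nn_integral_eq_integral) auto
    also have "\<dots> = 1"
      using int_u mean by (simp add: prob_space)
    finally show "emeasure ?N (space ?N) = 1" .
  qed
  have ac: "absolutely_continuous M ?N"
    by (rule absolutely_continuousI_density) simp
  have "AE x in M. ennreal (1 + u x) = RN_deriv M ?N x"
    by (rule RN_deriv_unique) auto
  then have D_eq: "AE x in M. ?D x = ln (1 + u x)"
    by eventually_elim (use nn in \<open>auto simp: entropy_density_def log_def dest: sym\<close>)
  then have D_N: "AE x in ?N. ?D x = ln (1 + u x)"
    by (auto simp: AE_density)
  \<comment> \<open>The logarithm differs from \<open>u x\<close> by at most twice its square, so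
    the bound is 1/2 + 1/2. It makes the entropy density integrable, which reduces
    \<open>relative_entropy\<close> to \<open>KL_divergence\<close>.\<close>
  have ln_bd: "\<bar>ln (1 + u x)\<bar> \<le> 1" for x
    using abs_ln_one_plus_x_minus_x_bound[OF u_half[of x]] u_half[of x]
      power_mono[OF u_half[of x], of 2] by (simp add: power2_eq_square)
  have int_D: "integrable ?N ?D"
  proof -
    interpret N: prob_space ?N by (rule ps)
    have "integrable ?N (\<lambda>x. ln (1 + u x))"
      by (rule N.integrable_const_bound[where B = 1]) (auto simp: ln_bd)
    then show ?thesis
      using D_N by (subst integrable_cong_AE) auto
  qed
  have "relative_entropy ?N M = ereal (expectation (\<lambda>x. (1 + u x) * log (exp 1) (1 + u x)))"
    using relative_entropy_eq_KL_divergence[OF ac int_D] KL_density[of "exp 1" "\<lambda>x. 1 + u x"] nn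
    by simp
  also have "\<dots> \<le> ereal (expectation (\<lambda>x. u x + (u x)\<^sup>2 / 2 + k ^ 3))"
  proof -
    have "(1 + u x) * log (exp 1) (1 + u x) \<le> u x + (u x)\<^sup>2 / 2 + k ^ 3" for x
      using one_plus_times_ln_le[OF u_half[of x]] power_mono[OF u_le[of x], of 3]
      by (simp add: log_def)
    moreover have "integrable M (\<lambda>x. (1 + u x) * log (exp 1) (1 + u x))"
    proof (rule integrable_const_bound[where B = 2])
      have "\<bar>(1 + u x) * ln (1 + u x)\<bar> \<le> 2 * 1" for x
        unfolding abs_mult using ln_bd u_half[of x] by (intro mult_mono) auto
      then show "AE x in M. norm ((1 + u x) * log (exp 1) (1 + u x)) \<le> 2"
        by (simp add: log_def)
    qed simp
    ultimately show ?thesis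
      using int_u int_u2 by (simp only: ereal_less_eq) (intro integral_mono, auto)
  qed
  also have "\<dots> = ereal (expectation (\<lambda>x. (u x)\<^sup>2) / 2 + k ^ 3)"
    using int_u int_u2 mean by (simp add: prob_space)
  finally show "relative_entropy ?N M \<le> ereal (expectation (\<lambda>x. (u x)\<^sup>2) / 2 + k ^ 3)" .
qed

section \<open>From a pointwise bound by the cost to a bound by the transport cost\<close>

text \<open>In the coefficient of \<theta>, \<open>1 / (2 * \<eta>)\<close> pays for pairs closer
  than \<delta> and \<open>2 * M / \<delta>\<^sup>2\<close> for the others; both terms being
  nonnegative, their sum serves both cases.\<close>

lemma descent_le_cost:
  fixes f \<sigma> :: "'a::metric_space \<Rightarrow> real"
  assumes \<theta>_ge: "\<And>t. t \<ge> 0 \<Longrightarrow> \<theta> t \<ge> min (t\<^sup>2) (a\<^sup>2)"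
    and \<delta>: "0 < \<delta>" "\<delta> \<le> a" and \<eta>: "0 < \<eta>"
    and f_le: "\<And>x. \<bar>f x\<bar> \<le> M"
    and \<sigma>: "\<And>x y. dist x y < \<delta> \<Longrightarrow> f x - f y \<le> \<sigma> x * dist x y"
  shows "f x - f y \<le> \<eta> / 2 * (\<sigma> x)\<^sup>2 + (1 / (2 * \<eta>) + 2 * M / \<delta>\<^sup>2) * \<theta> (dist x y)"
proof -
  let ?d = "dist x y"
  have M: "0 \<le> M"
    using f_le[of x] by linarith
  have \<theta>_nn: "0 \<le> \<theta> ?d"
    using order_trans[OF _ \<theta>_ge[of ?d]] by simp
  show ?thesis
  proof (cases "?d < \<delta>")
    case True
    \<comment> \<open>Since \<delta> is at most \<open>a\<close>, the minimum in the lower bound on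
      \<theta> is the squared distance here.\<close>
    have "?d\<^sup>2 \<le> a\<^sup>2"
      using True \<delta> by (intro power_mono) auto
    then have d_le: "?d\<^sup>2 \<le> \<theta> ?d"
      using \<theta>_ge[of ?d] by simp
    \<comment> \<open>Young's inequality with weight \<eta>, by completing the square.\<close>
    have "0 \<le> (\<eta> * \<sigma> x - ?d)\<^sup>2 / (2 * \<eta>)"
      using \<eta> by simp
    also have "\<dots> = \<eta> / 2 * (\<sigma> x)\<^sup>2 - \<sigma> x * ?d + ?d\<^sup>2 / (2 * \<eta>)"
      using \<eta> by (simp add: power2_eq_square field_simps)
    finally have "f x - f y \<le> \<eta> / 2 * (\<sigma> x)\<^sup>2 + 1 / (2 * \<eta>) * ?d\<^sup>2"
      using \<sigma>[OF True] by simp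
    also have "\<dots> \<le> \<eta> / 2 * (\<sigma> x)\<^sup>2 + (1 / (2 * \<eta>) + 2 * M / \<delta>\<^sup>2) * \<theta> ?d"
      using \<eta> d_le M \<theta>_nn by (intro add_left_mono mult_mono) auto
    finally show ?thesis .
  next
    case False
    have "\<delta>\<^sup>2 \<le> min (?d\<^sup>2) (a\<^sup>2)"
      using False \<delta> by (auto intro!: power_mono)
    then have \<delta>_le: "\<delta>\<^sup>2 \<le> \<theta> ?d"
      by (rule order_trans[OF _ \<theta>_ge]) simp
    have "f x - f y \<le> 2 * M"
      using f_le[of x] f_le[of y] by linarith
    also have "\<dots> = 2 * M / \<delta>\<^sup>2 * \<delta>\<^sup>2"
      using \<delta> by simp
    also have "\<dots> \<le> (1 / (2 * \<eta>) + 2 * M / \<delta>\<^sup>2) * \<theta> ?d"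
      using \<delta>_le \<eta> M by (intro mult_mono) auto
    also have "\<dots> \<le> \<eta> / 2 * (\<sigma> x)\<^sup>2 + (1 / (2 * \<eta>) + 2 * M / \<delta>\<^sup>2) * \<theta> ?d"
      using \<eta> by simp
    finally show ?thesis .
  qed
qed

text \<open>This is the easy direction of Kantorovich duality: the pointwise inequality is
  integrated against a coupling, the marginals identify the integrals of functions of one variable,
  and the infimum over couplings is taken last.\<close>

lemma integral_diff_le_transport_cost:
  fixes \<mu> \<nu> :: "'a::polish_space measure" and f s :: "'a \<Rightarrow> real"
  assumes f[measurable]: "f \<in> borel_measurable borel" and f_le: "\<And>x. \<bar>f x\<bar> \<le> M"
    and s[measurable]: "s \<in> borel_measurable borel" and s_le: "\<And>x. \<bar>s x\<bar> \<le> L"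
    and cost_cont: "continuous_on (UNIV :: ('a \<times> 'a) set) (\<lambda>(x, y). \<theta> (dist x y))"
    and \<theta>_nonneg: "\<And>t. t \<ge> 0 \<Longrightarrow> \<theta> t \<ge> 0"
    and K: "0 < K"
    and le: "\<And>x y. f x - f y \<le> s x + K * \<theta> (dist x y)"
    and cost: "transport_cost \<theta> \<mu> \<nu> \<le> ennreal c" and c: "0 \<le> c"
  shows "(\<integral>x. f x \<partial>\<mu>) - (\<integral>x. f x \<partial>\<nu>) \<le> (\<integral>x. s x \<partial>\<mu>) + K * c"
proof -
  define A where "A = (\<integral>x. f x \<partial>\<mu>) - (\<integral>x. f x \<partial>\<nu>) - (\<integral>x. s x \<partial>\<mu>)"
  \<comment> \<open>\<open>A\<close> may be negative, and \<open>ennreal\<close> then truncates to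
    0; this does no harm, as the quotient is finally compared with a nonnegative
    \<open>c\<close>.\<close>
  have "ennreal (A / K) \<le> (\<integral>\<^sup>+ (x, y). ennreal (\<theta> (dist x y)) \<partial>\<pi>)"
    if \<pi>: "\<pi> \<in> couplings \<mu> \<nu>" for \<pi>
  \<comment> \<open>Couplings of infinite cost are trivial; for the others the cost is integrable
    and real-valued integrals can be compared.\<close>
  proof (cases "(\<integral>\<^sup>+ z. ennreal (case z of (x, y) \<Rightarrow> \<theta> (dist x y)) \<partial>\<pi>) = \<infinity>")
    case True
    then show ?thesis by (simp add: case_prod_unfold)
  next
    case False
    interpret prob_space \<pi> using \<pi> by (simp add: couplings_def)
    have sets_\<pi>: "sets \<pi> = sets (borel \<Otimes>\<^sub>M borel)"
      and \<mu>_eq: "\<mu> = distr \<pi> borel fst" and \<nu>_eq: "\<nu> = distr \<pi> borel snd"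
      using \<pi> by (auto simp: couplings_def)
    note [measurable_cong] = sets_\<pi>
    \<comment> \<open>The Borel sigma-algebra of the product is the product sigma-algebra
      (\<open>borel_prod\<close>), so continuity of the cost gives measurability.\<close>
    have [measurable]: "(\<lambda>z::'a \<times> 'a. \<theta> (dist (fst z) (snd z))) \<in> borel_measurable (borel \<Otimes>\<^sub>M borel)"
      using borel_measurable_continuous_onI[OF cost_cont]
      by (simp add: borel_prod case_prod_unfold)
    have int_\<theta>: "integrable \<pi> (\<lambda>z. \<theta> (dist (fst z) (snd z)))"
      using False \<theta>_nonneg by (intro integrableI_nonneg) (auto simp: case_prod_unfold less_top)
    have int: "integrable \<pi> (\<lambda>z. f (fst z))" "integrable \<pi> (\<lambda>z. f (snd z))"
        "integrable \<pi> (\<lambda>z. s (fst z))"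
      by (rule integrable_const_bound[where B = M] integrable_const_bound[where B = L];
          simp add: f_le s_le)+
    have "A = (\<integral>z. f (fst z) - f (snd z) - s (fst z) \<partial>\<pi>)"
      unfolding A_def \<mu>_eq \<nu>_eq using int by (simp add: integral_distr)
    also have "\<dots> \<le> (\<integral>z. K * \<theta> (dist (fst z) (snd z)) \<partial>\<pi>)"
      using int int_\<theta> le by (intro integral_mono) (auto simp: algebra_simps)
    finally have "A / K \<le> (\<integral>z. \<theta> (dist (fst z) (snd z)) \<partial>\<pi>)"
      using K by (simp add: field_simps)
    then have "ennreal (A / K) \<le> ennreal (\<integral>z. \<theta> (dist (fst z) (snd z)) \<partial>\<pi>)"
      by (rule ennreal_leI)
    also have "\<dots> = (\<integral>\<^sup>+ z. ennreal (\<theta> (dist (fst z) (snd z))) \<partial>\<pi>)"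
      using int_\<theta> \<theta>_nonneg by (intro nn_integral_eq_integral[symmetric]) auto
    finally show ?thesis
      by (simp add: case_prod_unfold)
  qed
  then have "ennreal (A / K) \<le> transport_cost \<theta> \<mu> \<nu>"
    unfolding transport_cost_def by (rule INF_greatest)
  also note cost
  finally have "A / K \<le> c"
    using c by (simp add: ennreal_le_iff)
  then show ?thesis
    using K by (simp add: A_def field_simps)
qed

section \<open>The Poincare inequality at a fixed scale\<close>

text \<open>Perturbing \<mu> by a multiple \<epsilon> of the centred \<open>f\<close> makes both
  sides of the integrated inequality of order \<epsilon>. The entropy contributes half the variance
  in the limit, and absorbing it turns C/4 into C/2.\<close>

lemma Var_le_integral_scale_slope:
  fixes \<mu> :: "'a::polish_space measure" and f \<sigma> :: "'a \<Rightarrow> real"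
  assumes \<mu>: "prob_space \<mu>" "sets \<mu> = sets borel"
    and \<theta>_nonneg: "\<And>t. t \<ge> 0 \<Longrightarrow> \<theta> t \<ge> 0"
    and \<theta>_ge: "\<And>t. t \<ge> 0 \<Longrightarrow> \<theta> t \<ge> min (t\<^sup>2) (a\<^sup>2)"
    and cost_cont: "continuous_on (UNIV :: ('a \<times> 'a) set) (\<lambda>(x, y). \<theta> (dist x y))"
    and C: "C > 0"
    and T: "transport_entropy_ineq \<theta> C \<mu>"
    and f[measurable]: "f \<in> borel_measurable borel" and f_le: "\<And>x. \<bar>f x\<bar> \<le> M"
    and \<sigma>[measurable]: "\<sigma> \<in> borel_measurable borel" and \<sigma>_le: "\<And>x. \<bar>\<sigma> x\<bar> \<le> L"
    and \<delta>: "0 < \<delta>" "\<delta> \<le> a"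
    and descent: "\<And>x y. dist x y < \<delta> \<Longrightarrow> f x - f y \<le> \<sigma> x * dist x y"
  shows "Var \<mu> f \<le> C / 2 * (\<integral>x. (\<sigma> x)\<^sup>2 \<partial>\<mu>)"
proof -
  interpret prob_space \<mu> by (rule \<mu>)
  note [measurable_cong] = \<mu>(2)
  define I where "I = (\<integral>x. (\<sigma> x)\<^sup>2 \<partial>\<mu>)"
  define V where "V = Var \<mu> f"
  define g where "g x = f x - expectation f" for x
  have g[measurable]: "g \<in> borel_measurable borel"
    unfolding g_def by measurable
  have int_f: "integrable \<mu> f"
    by (rule integrable_const_bound[where B = M]) (auto simp: f_le)
  have f2_le: "\<bar>(f x)\<^sup>2\<bar> \<le> M\<^sup>2" for x
    using power_mono[OF f_le[of x], of 2] by simp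
  have int_f2: "integrable \<mu> (\<lambda>x. (f x)\<^sup>2)"
    by (rule integrable_const_bound[where B = "M\<^sup>2"]) (use f2_le in auto)
  have V_eq: "V = expectation (\<lambda>x. (g x)\<^sup>2)"
    unfolding V_def Var_def g_def using variance_eq[OF int_f int_f2] by simp
  have V_nn: "0 \<le> V"
    by (simp add: V_eq)
  have mean_g: "expectation g = 0"
    unfolding g_def using int_f by (simp add: prob_space)
  have M: "0 \<le> M"
    using f_le[of undefined] by linarith
  have g_le: "\<bar>g x\<bar> \<le> 2 * M + 1" for x
  proof -
    have "\<bar>expectation f\<bar> \<le> expectation (\<lambda>x. \<bar>f x\<bar>)"
      by (rule integral_abs_bound)
    also have "\<dots> \<le> expectation (\<lambda>x. M)"
      using int_f f_le by (intro integral_mono) auto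
    finally show ?thesis
      using f_le[of x] by (simp add: g_def prob_space)
  qed
  \<comment> \<open>The summand 1 keeps \<open>k\<close> positive even for \<open>M = 0\<close>, so
    that the range \<open>\<epsilon> < 1 / (2 * k)\<close> below makes sense.\<close>
  define k where "k = 2 * M + 1"
  have k: "0 < k" using M by (simp add: k_def)
  have step: "V \<le> C / 4 * I + V / 2 + \<epsilon> * k ^ 3 + 2 * M / \<delta>\<^sup>2 * C * (\<epsilon> * V / 2 + \<epsilon>\<^sup>2 * k ^ 3)"
    if \<epsilon>: "0 < \<epsilon>" "\<epsilon> < 1 / (2 * k)" for \<epsilon>
  proof -
    \<comment> \<open>Written as \<open>1 + u\<close> with \<open>u = - (\<epsilon> * g)\<close> to
      fit the entropy estimate. The minus sign moves mass away from large values of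
      \<open>f\<close>, so the mean of \<open>f\<close> drops by
      \<open>\<epsilon> * V\<close>.\<close>
    let ?\<nu> = "density \<mu> (\<lambda>x. ennreal (1 + - (\<epsilon> * g x)))"
    define h where "h = \<epsilon>\<^sup>2 * V / 2 + (\<epsilon> * k) ^ 3"
    have u_le: "\<bar>- (\<epsilon> * g x)\<bar> \<le> \<epsilon> * k" for x
      using \<epsilon> g_le[of x] by (simp add: abs_mult k_def)
    have k_half: "\<epsilon> * k \<le> 1 / 2"
      using \<epsilon> k by (simp add: field_simps)
    have mean_u: "expectation (\<lambda>x. - (\<epsilon> * g x)) = 0"
      using mean_g by simp
    have u_meas: "(\<lambda>x. - (\<epsilon> * g x)) \<in> borel_measurable \<mu>"
      by measurable
    have \<nu>: "prob_space ?\<nu>"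
      by (rule prob_space_density_one_plus[OF u_meas u_le k_half mean_u])
    have "relative_entropy ?\<nu> \<mu> \<le> ereal h"
      using relative_entropy_density_one_plus_le[OF u_meas u_le k_half mean_u]
      by (simp add: h_def V_eq power_mult_distrib)
    then have "ereal C * relative_entropy ?\<nu> \<mu> \<le> ereal C * ereal h"
      using C by (intro ereal_mult_left_mono) auto
    moreover have "enn2ereal (transport_cost \<theta> \<mu> ?\<nu>) \<le> ereal C * relative_entropy ?\<nu> \<mu>"
      using T \<nu> \<mu>(2) unfolding transport_entropy_ineq_def by simp
    ultimately have "enn2ereal (transport_cost \<theta> \<mu> ?\<nu>) \<le> ereal (C * h)"
      by simp
    moreover have Ch: "0 \<le> C * h"
      using C V_nn \<epsilon> k by (simp add: h_def)
    ultimately have cost: "transport_cost \<theta> \<mu> ?\<nu> \<le> ennreal (C * h)"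
      by (simp add: less_eq_ennreal.rep_eq enn2ereal_ennreal)
    \<comment> \<open>With this choice \<open>1 / (2 * \<eta>) * C\<close> is
      \<open>1 / \<epsilon>\<close>, so the leading entropy term becomes
      \<open>\<epsilon> * V / 2\<close>. Among multiples of \<epsilon> it gives the smallest final
      constant: \<eta> = s\<epsilon> leads to 2s^2/(4s - C), minimal at s = C/2.\<close>
    define \<eta> where "\<eta> = \<epsilon> * C / 2"
    have \<eta>: "0 < \<eta>" using \<epsilon> C by (simp add: \<eta>_def)
    define K where "K = 1 / (2 * \<eta>) + 2 * M / \<delta>\<^sup>2"
    have K: "0 < K"
      unfolding K_def using \<eta> M by (intro add_pos_nonneg) auto
    have s_le: "\<bar>\<eta> / 2 * (\<sigma> x)\<^sup>2\<bar> \<le> \<eta> / 2 * L\<^sup>2" for x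
      using \<eta> power_mono[OF \<sigma>_le[of x], of 2] by (simp add: abs_mult)
    have s_meas: "(\<lambda>x. \<eta> / 2 * (\<sigma> x)\<^sup>2) \<in> borel_measurable borel"
      by measurable
    have "(\<integral>x. f x \<partial>\<mu>) - (\<integral>x. f x \<partial>?\<nu>) \<le> (\<integral>x. \<eta> / 2 * (\<sigma> x)\<^sup>2 \<partial>\<mu>) + K * (C * h)"
    proof (rule integral_diff_le_transport_cost[OF f f_le s_meas s_le cost_cont _ K _ cost Ch])
      show "f x - f y \<le> \<eta> / 2 * (\<sigma> x)\<^sup>2 + K * \<theta> (dist x y)" for x y
        unfolding K_def by (rule descent_le_cost[OF \<theta>_ge \<delta> \<eta> f_le descent])
    qed (rule \<theta>_nonneg)
    also have "(\<integral>x. \<eta> / 2 * (\<sigma> x)\<^sup>2 \<partial>\<mu>) = \<eta> / 2 * I"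
      by (simp add: I_def)
    finally have *: "(\<integral>x. f x \<partial>\<mu>) - (\<integral>x. f x \<partial>?\<nu>) \<le> \<eta> / 2 * I + K * (C * h)" .
    have int_fg: "integrable \<mu> (\<lambda>x. g x * f x)"
    proof -
      have "integrable \<mu> (\<lambda>x. (f x)\<^sup>2 - expectation f * f x)"
        using int_f int_f2 by simp
      then show ?thesis
        by (simp add: g_def algebra_simps power2_eq_square)
    qed
    have "(\<integral>x. f x \<partial>?\<nu>) = (\<integral>x. (1 + - (\<epsilon> * g x)) * f x \<partial>\<mu>)"
    proof (subst integral_real_density)
      show "AE x in \<mu>. 0 \<le> 1 + - (\<epsilon> * g x)"
        using u_le k_half by (intro AE_I2) (smt (verit) field_sum_of_halves)
    qed auto
    also have "\<dots> = (\<integral>x. f x - \<epsilon> * (g x * f x) \<partial>\<mu>)"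
      by (simp add: algebra_simps)
    also have "\<dots> = (\<integral>x. f x \<partial>\<mu>) - \<epsilon> * (\<integral>x. g x * f x \<partial>\<mu>)"
      using int_f int_fg by simp
    also have "(\<integral>x. g x * f x \<partial>\<mu>) = V"
    proof -
      have "(\<integral>x. g x * f x \<partial>\<mu>) = (\<integral>x. (f x)\<^sup>2 - expectation f * f x \<partial>\<mu>)"
        by (simp add: g_def algebra_simps power2_eq_square)
      also have "\<dots> = V"
        using int_f int_f2 by (simp add: V_def Var_def power2_eq_square)
      finally show ?thesis .
    qed
    finally have "\<epsilon> * V \<le> \<eta> / 2 * I + K * (C * h)"
      using * by simp
    also have "\<dots> = \<epsilon> * (C / 4 * I + V / 2 + \<epsilon> * k ^ 3
        + 2 * M / \<delta>\<^sup>2 * C * (\<epsilon> * V / 2 + \<epsilon>\<^sup>2 * k ^ 3))"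
    proof -
      have 1: "1 / (2 * \<eta>) * C * h = \<epsilon> * (V / 2 + \<epsilon> * k ^ 3)"
        using \<epsilon> C by (simp add: \<eta>_def h_def field_simps power2_eq_square power3_eq_cube)
      have 2: "h = \<epsilon> * (\<epsilon> * V / 2 + \<epsilon>\<^sup>2 * k ^ 3)"
        by (simp add: h_def algebra_simps power2_eq_square power3_eq_cube)
      have "\<eta> / 2 * I + K * (C * h)
          = \<epsilon> * (C / 4 * I) + 1 / (2 * \<eta>) * C * h + 2 * M / \<delta>\<^sup>2 * C * h"
        unfolding K_def by (simp add: \<eta>_def ring_distribs mult.assoc)
      also have "\<dots> = \<epsilon> * (C / 4 * I) + \<epsilon> * (V / 2 + \<epsilon> * k ^ 3)
          + 2 * M / \<delta>\<^sup>2 * C * (\<epsilon> * (\<epsilon> * V / 2 + \<epsilon>\<^sup>2 * k ^ 3))"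
        unfolding 1 by (subst 2) (rule refl)
      finally show ?thesis
        by (simp add: algebra_simps)
    qed
    finally show ?thesis
      using \<epsilon> by simp
  qed
  \<comment> \<open>The bound of \<open>step\<close> with 0 put for \<epsilon>, left unsimplified so
    that it is literally the limit produced by \<open>tendsto_intros\<close>.\<close>
  have "V \<le> C / 4 * I + V / 2 + 0 * k ^ 3 + 2 * M / \<delta>\<^sup>2 * C * (0 * V / 2 + 0\<^sup>2 * k ^ 3)"
  proof (rule tendsto_lowerbound)
    show "((\<lambda>\<epsilon>. C / 4 * I + V / 2 + \<epsilon> * k ^ 3 + 2 * M / \<delta>\<^sup>2 * C * (\<epsilon> * V / 2 + \<epsilon>\<^sup>2 * k ^ 3))
        \<longlongrightarrow> C / 4 * I + V / 2 + 0 * k ^ 3 + 2 * M / \<delta>\<^sup>2 * C * (0 * V / 2 + 0\<^sup>2 * k ^ 3))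
        (at_right 0)"
      by (intro tendsto_intros) auto
    show "\<forall>\<^sub>F \<epsilon> in at_right 0.
        V \<le> C / 4 * I + V / 2 + \<epsilon> * k ^ 3 + 2 * M / \<delta>\<^sup>2 * C * (\<epsilon> * V / 2 + \<epsilon>\<^sup>2 * k ^ 3)"
      using k step by (auto simp: eventually_at_right_field intro!: exI[of _ "1 / (2 * k)"])
  qed simp
  then show ?thesis
    by (simp add: V_def I_def)
qed

section \<open>Descending slope at a positive scale\<close>

text \<open>The punctured balls are those of \<open>Limsup_within\<close>, so the infimum over
  positive \<delta> is \<open>descending_slope f x\<close>. If the punctured ball is empty, the
  supremum in \<open>ennreal\<close> is 0.\<close>

definition scale_slope :: "('a::metric_space \<Rightarrow> real) \<Rightarrow> real \<Rightarrow> 'a \<Rightarrow> ennreal" where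
  "scale_slope f \<delta> x = (SUP y\<in>ball x \<delta> - {x}. ennreal (max 0 (- (f y - f x)) / dist x y))"

text \<open>For continuous \<open>f\<close> and fixed \<open>y\<close> the difference quotient is continuous on the open set
  \<open>{x. 0 < d(x,y) < \<delta>}\<close>, so the supremum over \<open>y\<close> is lower semicontinuous.\<close>

lemma borel_measurable_scale_slope:
  assumes f: "continuous_on UNIV f"
  shows "scale_slope f \<delta> \<in> borel_measurable borel"
proof (rule borel_measurableI_greater)
  fix t :: ennreal
  let ?q = "\<lambda>y x. ennreal (max 0 (- (f y - f x)) / dist x y)"
  have "open {x \<in> ball y \<delta> - {y}. t < ?q y x}" for y
  proof -
    have "continuous_on (ball y \<delta> - {y}) (?q y)"
      by (intro continuous_on_ennreal continuous_intros continuous_on_subset[OF f]) auto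
    then have "open (?q y -` {t<..} \<inter> (ball y \<delta> - {y}))"
      by (subst (asm) continuous_on_open_vimage) (auto simp: open_Diff)
    moreover have "?q y -` {t<..} \<inter> (ball y \<delta> - {y}) = {x \<in> ball y \<delta> - {y}. t < ?q y x}"
      by auto
    ultimately show ?thesis by simp
  qed
  then have "open (\<Union>y. {x \<in> ball y \<delta> - {y}. t < ?q y x})"
    by blast
  \<comment> \<open>By symmetry of the distance, \<open>y\<close> lies in the punctured ball about
    \<open>x\<close> exactly when \<open>x\<close> lies in the one about \<open>y\<close>.\<close>
  also have "(\<Union>y. {x \<in> ball y \<delta> - {y}. t < ?q y x}) = {x \<in> space borel. t < scale_slope f \<delta> x}"
    by (auto simp: scale_slope_def less_SUP_iff dist_commute)
  finally show "{x \<in> space borel. t < scale_slope f \<delta> x} \<in> sets borel"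
    by simp
qed

lemma scale_slope_mono: "\<delta> \<le> \<delta>' \<Longrightarrow> scale_slope f \<delta> x \<le> scale_slope f \<delta>' x"
  unfolding scale_slope_def by (intro SUP_subset_mono) auto

text \<open>The slope is an infimum over all radii, and by the Archimedean property the radii
  \<open>\<rho> / real (Suc n)\<close> fall below each of them; monotonicity in the scale turns the
  infimum into a limit. A sequence is what dominated convergence asks for.\<close>

lemma scale_slope_tendsto_descending_slope:
  assumes "0 < \<rho>"
  shows "(\<lambda>n. scale_slope f (\<rho> / real (Suc n)) x) \<longlonglongrightarrow> descending_slope f x"
proof -
  have "decseq (\<lambda>n. scale_slope f (\<rho> / real (Suc n)) x)"
    using assms by (intro decseq_SucI scale_slope_mono) (simp add: field_simps)
  moreover have "descending_slope f x = (INF n. scale_slope f (\<rho> / real (Suc n)) x)"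
    unfolding descending_slope_def Limsup_within
  proof (rule INF_eq)
    fix e :: real assume "e \<in> {0<..}"
    then obtain n where "\<rho> / real (Suc n) < e"
      using assms reals_Archimedean[of "e / \<rho>"] by (auto simp: field_simps)
    then have "scale_slope f (\<rho> / real (Suc n)) x \<le> scale_slope f e x"
      by (intro scale_slope_mono) simp
    then show "\<exists>n\<in>UNIV. scale_slope f (\<rho> / real (Suc n)) x
        \<le> (SUP y\<in>UNIV \<inter> ball x e - {x}. ennreal (max 0 (- (f y - f x)) / dist x y))"
      by (auto simp: scale_slope_def)
  next
    fix n :: nat
    show "\<exists>e\<in>{0<..}. (SUP y\<in>UNIV \<inter> ball x e - {x}. ennreal (max 0 (- (f y - f x)) / dist x y))
        \<le> scale_slope f (\<rho> / real (Suc n)) x"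
      using assms by (intro bexI[of _ "\<rho> / real (Suc n)"]) (auto simp: scale_slope_def)
  qed
  ultimately show ?thesis
    by (metis LIMSEQ_INF)
qed

lemma scale_slope_le:
  assumes "0 \<le> L" "\<And>y. dist x y < \<delta> \<Longrightarrow> \<bar>f y - f x\<bar> \<le> L * dist x y"
  shows "scale_slope f \<delta> x \<le> ennreal L"
  unfolding scale_slope_def
proof (rule SUP_least, rule ennreal_leI)
  fix y assume "y \<in> ball x \<delta> - {x}"
  then have "0 < dist x y" "\<bar>f y - f x\<bar> \<le> L * dist x y"
    using assms(2) by auto
  with assms(1) show "max 0 (- (f y - f x)) / dist x y \<le> L"
    by (auto simp: divide_le_eq)
qed

text \<open>Supplies the descent hypothesis of \<open>Var_le_integral_scale_slope\<close>.
  Finiteness matters because \<open>enn2real\<close> sends infinity to 0.\<close>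

lemma descent_le_scale_slope:
  assumes "scale_slope f \<delta> x < \<infinity>" "dist x y < \<delta>"
  shows "f x - f y \<le> enn2real (scale_slope f \<delta> x) * dist x y"
proof (cases "x = y")
  case False
  have "ennreal (max 0 (- (f y - f x)) / dist x y) \<le> scale_slope f \<delta> x"
    unfolding scale_slope_def using False assms(2) by (intro SUP_upper) auto
  then have "max 0 (- (f y - f x)) / dist x y \<le> enn2real (scale_slope f \<delta> x)"
    using assms(1) enn2real_mono by fastforce
  then show ?thesis
    using False by (simp add: divide_le_eq)
qed simp

section \<open>Consequences of a finite Lipschitz constant at scale \<open>r\<close>\<close>

lemma Lip_finiteE:
  fixes f :: "'a::metric_space \<Rightarrow> real"
  assumes "Lip f r < \<infinity>"
  obtains L where "0 \<le> L" "\<And>x y. dist x y \<le> r \<Longrightarrow> \<bar>f y - f x\<bar> \<le> L * dist x y"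
proof
  show "0 \<le> enn2real (Lip f r)" by simp
  fix x y :: 'a assume r: "dist x y \<le> r"
  show "\<bar>f y - f x\<bar> \<le> enn2real (Lip f r) * dist x y"
  proof (cases "x = y")
    case False
    then have "ennreal (\<bar>f y - f x\<bar> / dist x y) \<le> Lip f r"
      unfolding Lip_def using r by (intro SUP_upper2[of "(x, y)"]) auto
    then have "\<bar>f y - f x\<bar> / dist x y \<le> enn2real (Lip f r)"
      using assms enn2real_mono by fastforce
    then show ?thesis
      using False by (simp add: divide_le_eq)
  qed simp
qed

lemma continuous_on_locally_Lipschitz:
  fixes f :: "'a::metric_space \<Rightarrow> real"
  assumes r: "0 < r" and L: "0 \<le> L" "\<And>x y. dist x y \<le> r \<Longrightarrow> \<bar>f y - f x\<bar> \<le> L * dist x y"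
  shows "continuous_on UNIV f"
  unfolding continuous_on_def
proof
  fix x :: 'a
  have "((\<lambda>y. L * dist x y) \<longlongrightarrow> L * dist x x) (at x)"
    by (intro tendsto_intros)
  then have "((\<lambda>y. L * dist x y) \<longlongrightarrow> 0) (at x)"
    by simp
  moreover have "\<forall>\<^sub>F y in at x. norm (f y - f x) \<le> L * dist x y"
    using r L(2)[of x] by (auto simp: eventually_at dist_commute[of _ x] intro!: exI[of _ r])
  ultimately have "((\<lambda>y. f y - f x) \<longlongrightarrow> 0) (at x)"
    by (rule Lim_null_comparison[rotated])
  then show "(f \<longlongrightarrow> f x) (at x)"
    by (rule LIM_zero_cancel)
qed

section \<open>Passage to vanishing scale\<close>

theorem proposition1p14:
  fixes \<mu> :: "'a::polish_space measure"
    and \<theta> :: "real \<Rightarrow> real"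
    and a C r :: real
    and f :: "'a \<Rightarrow> real"
  assumes proper: "\<And>(x::'a) R. compact (cball x R)"
    and \<mu>: "prob_space \<mu>" "sets \<mu> = sets borel"
    and \<theta>_nonneg: "\<And>t. t \<ge> 0 \<Longrightarrow> \<theta> t \<ge> 0"
    and a: "a > 0"
    and \<theta>_ge: "\<And>t. t \<ge> 0 \<Longrightarrow> \<theta> t \<ge> min (t\<^sup>2) (a\<^sup>2)"
    and cost_cont: "continuous_on (UNIV :: ('a \<times> 'a) set) (\<lambda>(x, y). \<theta> (dist x y))"
    and C: "C > 0"
    and T: "transport_entropy_ineq \<theta> C \<mu>"
    and f_bdd: "bounded (range f)"
    and r: "r > 0"
    and f_Lip: "Lip f r < \<infinity>"
  shows "ennreal (Var \<mu> f) \<le> ennreal (C / 2) * (\<integral>\<^sup>+ x. (descending_slope f x)\<^sup>2 \<partial>\<mu>)"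
proof -
  interpret prob_space \<mu> by (rule \<mu>)
  note [measurable_cong] = \<mu>(2)
  obtain M where M: "\<And>x. \<bar>f x\<bar> \<le> M"
    using f_bdd by (auto simp: bounded_iff)
  obtain L where L: "0 \<le> L" "\<And>x y. dist x y \<le> r \<Longrightarrow> \<bar>f y - f x\<bar> \<le> L * dist x y"
    using Lip_finiteE[OF f_Lip] by blast
  have f_cont: "continuous_on UNIV f"
    by (rule continuous_on_locally_Lipschitz[OF r L])
  have f: "f \<in> borel_measurable borel"
    by (rule borel_measurable_continuous_onI[OF f_cont])
  note [measurable] = borel_measurable_scale_slope[OF f_cont]
  \<comment> \<open>Scales up to \<open>a\<close> are admissible for the fixed-scale inequality;
    scales up to \<open>r\<close> are controlled by the Lipschitz constant.\<close>
  define \<rho> where "\<rho> = min a r"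
  have \<rho>: "0 < \<rho>" using a r by (simp add: \<rho>_def)
  define S where "S n x = scale_slope f (\<rho> / real (Suc n)) x" for n x
  have S_meas[measurable]: "S n \<in> borel_measurable borel" for n
    unfolding S_def by measurable
  have small: "0 < \<rho> / real (Suc n)" "\<rho> / real (Suc n) \<le> \<rho>" for n
    using \<rho> by (auto simp: field_simps)
  \<comment> \<open>This uniform bound provides the dominating constant and makes
    \<open>S n x\<close> finite, so that \<open>enn2real\<close> loses nothing.\<close>
  have S_le: "S n x \<le> ennreal L" for n x
    unfolding S_def using L small(2)[of n] by (intro scale_slope_le) (auto simp: \<rho>_def)
  then have S_fin: "S n x < \<infinity>" for n x
    using le_less_trans[OF S_le] by simp
  have S_lim: "(\<lambda>n. S n x) \<longlonglongrightarrow> descending_slope f x" for x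
    unfolding S_def by (rule scale_slope_tendsto_descending_slope[OF \<rho>])
  have slope_le: "descending_slope f x \<le> ennreal L" for x
    using S_lim by (rule LIMSEQ_le_const2) (auto simp: S_le)
  have slope_meas[measurable]: "descending_slope f \<in> borel_measurable borel"
    by (rule borel_measurable_LIMSEQ_order[OF S_lim]) measurable
  have "(\<lambda>n. \<integral>\<^sup>+ x. (S n x)\<^sup>2 \<partial>\<mu>) \<longlonglongrightarrow> (\<integral>\<^sup>+ x. (descending_slope f x)\<^sup>2 \<partial>\<mu>)"
  proof (rule nn_integral_dominated_convergence)
    show "AE x in \<mu>. (S n x)\<^sup>2 \<le> (ennreal L)\<^sup>2" for n
      by (intro AE_I2 power_mono S_le) simp
    show "(\<integral>\<^sup>+ x. (ennreal L)\<^sup>2 \<partial>\<mu>) < \<infinity>"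
      using L(1) by (simp add: emeasure_space_1 ennreal_power)
    have "descending_slope f x \<noteq> \<infinity>" for x
      using slope_le[of x] by (auto simp: top_unique)
    then show "AE x in \<mu>. (\<lambda>n. (S n x)\<^sup>2) \<longlonglongrightarrow> (descending_slope f x)\<^sup>2"
      unfolding power2_eq_square by (intro AE_I2 tendsto_mult_ennreal S_lim) auto
  qed measurable
  then have "(\<lambda>n. ennreal (C / 2) * (\<integral>\<^sup>+ x. (S n x)\<^sup>2 \<partial>\<mu>))
      \<longlonglongrightarrow> ennreal (C / 2) * (\<integral>\<^sup>+ x. (descending_slope f x)\<^sup>2 \<partial>\<mu>)"
    by (intro ennreal_tendsto_cmult) auto
  moreover have "ennreal (Var \<mu> f) \<le> ennreal (C / 2) * (\<integral>\<^sup>+ x. (S n x)\<^sup>2 \<partial>\<mu>)" for n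
  proof -
    let ?\<sigma> = "\<lambda>x. enn2real (S n x)"
    have \<sigma>_le: "\<bar>?\<sigma> x\<bar> \<le> L" for x
      using enn2real_mono[OF S_le[of n x]] L(1) by simp
    have \<sigma>_meas: "?\<sigma> \<in> borel_measurable borel"
      by measurable
    have scale: "\<rho> / real (Suc n) \<le> a"
      using small(2)[of n] by (simp add: \<rho>_def)
    have "f x - f y \<le> ?\<sigma> x * dist x y" if "dist x y < \<rho> / real (Suc n)" for x y
      using descent_le_scale_slope[OF _ that] S_fin[of n x] by (simp add: S_def)
    from Var_le_integral_scale_slope[OF \<mu> \<theta>_nonneg \<theta>_ge cost_cont C T f M \<sigma>_meas \<sigma>_le
        small(1) scale this]
    have "ennreal (Var \<mu> f) \<le> ennreal (C / 2 * (\<integral>x. (?\<sigma> x)\<^sup>2 \<partial>\<mu>))"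
      by (intro ennreal_leI)
    also have "\<dots> = ennreal (C / 2) * (\<integral>\<^sup>+ x. ennreal ((?\<sigma> x)\<^sup>2) \<partial>\<mu>)"
    proof -
      have "integrable \<mu> (\<lambda>x. (?\<sigma> x)\<^sup>2)"
        using power_mono[OF \<sigma>_le] by (intro integrable_const_bound[where B = "L\<^sup>2"]) auto
      then show ?thesis
        by (subst nn_integral_eq_integral)
          (use C in \<open>auto simp: ennreal_mult[symmetric]\<close>)
    qed
    also have "(\<lambda>x. ennreal ((?\<sigma> x)\<^sup>2)) = (\<lambda>x. (S n x)\<^sup>2)"
      using S_fin[of n] by (simp add: ennreal_power[symmetric])
    finally show ?thesis .
  qed
  ultimately show ?thesis
    by (intro LIMSEQ_le_const) auto
qed

end
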